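(* Let $\mathcal T$ be a planar triangulation with $N_v$ vertices $\mathbf x_i=(x_i,y_i)\in\mathbb R^2$, $0\le i\le N_v-1$, and $N_c$ positively oriented (nondegenerate) triangles $\tau_0,\dots,\tau_{N_c-1}$, with fixed connectivity. Let $\mu_n=\frac{R_n}{2r_n}$ be the radius ratio of $\tau_n$, where $R_n$ is its circumradius and $r_n$ its inradius, and regard $$F=\frac1{N_c}\sum_{n=0}^{N_c-1}\mu_n$$ as a function of the vector of vertex coordinates $\mathbf V=[\mathbf X^T,\mathbf Y^T]^T\in\mathbb R^{2N_v}$, where $\mathbf X=[x_0,\dots,x_{N_v-1}]^T$ and $\mathbf Y=[y_0,\dots,y_{N_v-1}]^T$. Let $\mathbf A$ and $\mathbf B$ be the $N_v\times N_v$ matrices (depending on $\mathbf V$) assembled from the element matrices $\mathbf A_n,\mathbf B_n$ defined in the context. Then $$\nabla_{\mathbf V}F=\begin{bmatrix}\mathbf A&\mathbf B\\-\mathbf B&\mathbf A\end{bmatrix}\begin{bmatrix}\mathbf X\\\mathbf Y\end{bmatrix},$$ where $\mathbf A$ is a Laplacian matrix and $\mathbf B$ is an antisymmetric matrix.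
   Context: A triangle with ordered vertices $(\mathbf x_0,\mathbf x_1,\mathbf x_2)$ is positively oriented if $\det[\mathbf x_1-\mathbf x_0,\ \mathbf x_2-\mathbf x_0]>0$. A Laplacian matrix is a real symmetric matrix with nonpositive off-diagonal entries and zero row sums. Element matrices. Let $\tau_n$ have (local, ordered) vertices $\mathbf x_0,\mathbf x_1,\mathbf x_2$, area $|\tau_n|$, and edge lengths $l_0=|\mathbf x_1-\mathbf x_2|$, $l_1=|\mathbf x_2-\mathbf x_0|$, $l_2=|\mathbf x_0-\mathbf x_1|$. Put $p=l_0+l_1+l_2$, $c=\frac1{|\tau_n|}$, $c_i=\frac1{p\,l_i}+\frac1{l_i^2}$ for $i=0,1,2$, and $c_{ij}=c_i+c_j$. Define $$\mathbf A_n=\mu_n\begin{pmatrix}c_{12}&-c_2&-c_1\\-c_2&c_{20}&-c_0\\-c_1&-c_0&c_{01}\end{pmatrix},\qquad \mathbf B_n=\mu_n\begin{pmatrix}0&-c&c\\c&0&-c\\-c&c&0\end{pmatrix}.$$ Assembly. If the local vertices $0,1,2$ of $\tau_n$ have global indices $g_n(0),g_n(1),g_n(2)$ (distinct), then $$\mathbf A_{ij}=\frac1{N_c}\sum_{n=0}^{N_c-1}\ \sum_{\substack{0\le a,b\le 2\\ g_n(a)=i,\ g_n(b)=j}}(\mathbf A_n)_{ab},$$ and $\mathbf B$ is obtained in the same way from the $\mathbf B_n$. *)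

theory Defs
  imports "HOL-Analysis.Analysis"
begin

(* A triangle is given by its ordered vertices x 0, x 1, x 2; the other values of x are irrelevant. *)

definition triangle_hull :: "(nat \<Rightarrow> real^2) \<Rightarrow> (real^2) set" where
  "triangle_hull x = convex hull (x ` {..<3})"

definition positively_oriented :: "(nat \<Rightarrow> real^2) \<Rightarrow> bool" where
  "positively_oriented x \<longleftrightarrow>
     det (transpose (vector [x 1 - x 0, x 2 - x 0]) :: real^2^2) > 0"

definition triangle_area :: "(nat \<Rightarrow> real^2) \<Rightarrow> real" where
  "triangle_area x = measure lborel (triangle_hull x)"

(* The length of the edge opposite to vertex i. *)
definition edge_length :: "(nat \<Rightarrow> real^2) \<Rightarrow> nat \<Rightarrow> real" where
  "edge_length x i = norm (x ((i + 1) mod 3) - x ((i + 2) mod 3))"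

definition perimeter :: "(nat \<Rightarrow> real^2) \<Rightarrow> real" where
  "perimeter x = edge_length x 0 + edge_length x 1 + edge_length x 2"

(* The radius of the circle through the three vertices. *)
definition circumradius :: "(nat \<Rightarrow> real^2) \<Rightarrow> real" where
  "circumradius x = (THE R. \<exists>z. \<forall>i<3. dist z (x i) = R)"

(* The radius of the inscribed circle: its centre lies in the triangle (which rules out the
   excircles) and it is tangent to the three side lines, i.e. its radius is the distance of the
   centre from each of them. *)
definition inradius :: "(nat \<Rightarrow> real^2) \<Rightarrow> real" where
  "inradius x = (THE r. \<exists>z \<in> triangle_hull x.
      \<forall>i<3. infdist z (affine hull (x ` ({..<3} - {i}))) = r)"

definition radius_ratio :: "(nat \<Rightarrow> real^2) \<Rightarrow> real" where
  "radius_ratio x = circumradius x / (2 * inradius x)"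

definition coeff_c :: "(nat \<Rightarrow> real^2) \<Rightarrow> nat \<Rightarrow> real" where
  "coeff_c x i = 1 / (perimeter x * edge_length x i) + 1 / (edge_length x i)\<^sup>2"

(* Element matrices are indexed by the local vertex numbers 0, 1, 2. *)

definition element_A :: "(nat \<Rightarrow> real^2) \<Rightarrow> nat \<Rightarrow> nat \<Rightarrow> real" where
  "element_A x a b =
     (let c0 = coeff_c x 0; c1 = coeff_c x 1; c2 = coeff_c x 2
      in radius_ratio x *
           [[c1 + c2, - c2,     - c1    ],
            [- c2,    c2 + c0,  - c0    ],
            [- c1,    - c0,     c0 + c1 ]] ! a ! b)"

definition element_B :: "(nat \<Rightarrow> real^2) \<Rightarrow> nat \<Rightarrow> nat \<Rightarrow> real" where
  "element_B x a b =
     (let c = 1 / triangle_area x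
      in radius_ratio x *
           [[0,   - c, c  ],
            [c,   0,   - c],
            [- c, c,   0  ]] ! a ! b)"

(* The vertices of a mesh are indexed by a finite type, so that N_v is its cardinality. Vectors of
   R^(2 N_v) are indexed by the sum of two copies of it: Inl for X, Inr for Y. *)

definition stack :: "real^'v::finite \<Rightarrow> real^'v \<Rightarrow> real^('v + 'v)" where
  "stack X Y = (\<chi> k. case k of Inl i \<Rightarrow> X $ i | Inr i \<Rightarrow> Y $ i)"

definition block_matrix ::
    "real^'v^'v \<Rightarrow> real^'v^'v \<Rightarrow> real^'v^'v \<Rightarrow> real^'v^'v \<Rightarrow> real^('v + 'v)^('v + 'v)" where
  "block_matrix P Q R S = (\<chi> k l.
     case k of
       Inl i \<Rightarrow> (case l of Inl j \<Rightarrow> P $ i $ j | Inr j \<Rightarrow> Q $ i $ j)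
     | Inr i \<Rightarrow> (case l of Inl j \<Rightarrow> R $ i $ j | Inr j \<Rightarrow> S $ i $ j))"

definition mesh_vertex :: "real^('v + 'v) \<Rightarrow> 'v::finite \<Rightarrow> real^2" where
  "mesh_vertex V i = vector [V $ Inl i, V $ Inr i]"

(* The connectivity g maps a triangle number n < Nc and a local vertex number a < 3 to the global
   index of that vertex. *)

definition mesh_triangle :: "(nat \<Rightarrow> nat \<Rightarrow> 'v::finite) \<Rightarrow> real^('v + 'v) \<Rightarrow> nat \<Rightarrow> nat \<Rightarrow> real^2" where
  "mesh_triangle g V n = (\<lambda>a. mesh_vertex V (g n a))"

(* The triangles are positively oriented, pairwise distinct and meet along common faces; the points
   mesh_vertex V i are pairwise distinct and are exactly the vertices of the triangles (whence
   Nc > 0). *)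
definition planar_triangulation ::
    "nat \<Rightarrow> (nat \<Rightarrow> nat \<Rightarrow> 'v::finite) \<Rightarrow> real^('v + 'v) \<Rightarrow> bool" where
  "planar_triangulation Nc g V \<longleftrightarrow>
     (\<forall>n<Nc. inj_on (g n) {..<3}) \<and>
     (\<Union>n<Nc. g n ` {..<3}) = UNIV \<and>
     inj (mesh_vertex V) \<and>
     (\<forall>n<Nc. positively_oriented (mesh_triangle g V n)) \<and>
     inj_on (\<lambda>n. triangle_hull (mesh_triangle g V n)) {..<Nc} \<and>
     triangulation ((\<lambda>n. triangle_hull (mesh_triangle g V n)) ` {..<Nc})"

definition mean_radius_ratio ::
    "nat \<Rightarrow> (nat \<Rightarrow> nat \<Rightarrow> 'v::finite) \<Rightarrow> real^('v + 'v) \<Rightarrow> real" where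
  "mean_radius_ratio Nc g V = 1 / real Nc * (\<Sum>n<Nc. radius_ratio (mesh_triangle g V n))"

definition assemble ::
    "nat \<Rightarrow> (nat \<Rightarrow> nat \<Rightarrow> 'v::finite) \<Rightarrow> (nat \<Rightarrow> nat \<Rightarrow> nat \<Rightarrow> real) \<Rightarrow> real^'v^'v" where
  "assemble Nc g M = (\<chi> i j. 1 / real Nc *
     (\<Sum>n<Nc. \<Sum>(a, b) \<in> {(a, b). a < 3 \<and> b < 3 \<and> g n a = i \<and> g n b = j}. M n a b))"

definition matrix_A ::
    "nat \<Rightarrow> (nat \<Rightarrow> nat \<Rightarrow> 'v::finite) \<Rightarrow> real^('v + 'v) \<Rightarrow> real^'v^'v" where
  "matrix_A Nc g V = assemble Nc g (\<lambda>n. element_A (mesh_triangle g V n))"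

definition matrix_B ::
    "nat \<Rightarrow> (nat \<Rightarrow> nat \<Rightarrow> 'v::finite) \<Rightarrow> real^('v + 'v) \<Rightarrow> real^'v^'v" where
  "matrix_B Nc g V = assemble Nc g (\<lambda>n. element_B (mesh_triangle g V n))"

definition laplacian_matrix :: "real^'v^'v \<Rightarrow> bool" where
  "laplacian_matrix M \<longleftrightarrow>
     transpose M = M \<and>
     (\<forall>i j. i \<noteq> j \<longrightarrow> M $ i $ j \<le> 0) \<and>
     (\<forall>i. (\<Sum>j\<in>UNIV. M $ i $ j) = 0)"

definition antisymmetric_matrix :: "real^'v^'v \<Rightarrow> bool" where
  "antisymmetric_matrix M \<longleftrightarrow> transpose M = - M"

end

theory Submission
  imports Defs
begin

text \<open>
  Let \<open>D\<close> be twice the signed area, \<open>l\<^sub>0, l\<^sub>1, l\<^sub>2\<close> the edge lengths and \<open>p\<close> the perimeter.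
  Since \<open>R = l\<^sub>0 l\<^sub>1 l\<^sub>2 / (2 \<bar>D\<bar>)\<close> and \<open>r = \<bar>D\<bar> / p\<close> (the incentre has barycentric coordinates
  \<open>l\<^sub>i / p\<close>), the radius ratio is \<open>p l\<^sub>0 l\<^sub>1 l\<^sub>2 / (2 D)\<^sup>2\<close>, on a neighbourhood of a nondegenerate
  triangle. In its logarithmic derivative the contribution of \<open>p l\<^sub>0 l\<^sub>1 l\<^sub>2\<close> gives the element matrix
  \<open>A\<^sub>n\<close>, and that of \<open>D\<close>, whose gradient at a vertex is the opposite edge turned by a right angle,
  gives \<open>B\<^sub>n\<close>. All properties of the global matrices are inherited from the element matrices.
\<close>

section \<open>Cross product in the plane and distance to a line\<close>

definition wedge :: "real^2 \<Rightarrow> real^2 \<Rightarrow> real" where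
  "wedge u v = u $ 1 * v $ 2 - u $ 2 * v $ 1"

lemma inner_real2: "u \<bullet> v = u $ 1 * v $ 1 + u $ 2 * v $ 2" for u v :: "real^2"
  by (simp add: inner_vec_def sum_2)

lemma power2_norm_real2: "(norm u)\<^sup>2 = (u $ 1)\<^sup>2 + (u $ 2)\<^sup>2" for u :: "real^2"
  unfolding power2_norm_eq_inner inner_real2 by (simp add: power2_eq_square)

lemma wedge_Lagrange: "(wedge u v)\<^sup>2 + (u \<bullet> v)\<^sup>2 = (norm u)\<^sup>2 * (norm v)\<^sup>2"
  unfolding wedge_def inner_real2 power2_norm_real2 by algebra

text \<open>The cross product is the area of a parallelogram, hence base times height. It does not
  change when the reference point moves along the line, and \<open>wedge_Lagrange\<close> bounds it
  by the product of the norms, with equality at the foot of the perpendicular.\<close>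

lemma infdist_line:
  assumes "a \<noteq> b"
  shows "infdist z (affine hull {a, b}) = \<bar>wedge (b - a) (z - a)\<bar> / norm (b - a)"
proof -
  define d where "d = b - a"
  have d: "norm d > 0" using assms by (simp add: d_def)
  have line: "affine hull {a, b} = range (\<lambda>t. a + t *\<^sub>R d)"
    by (simp add: affine_hull_2_alt d_def)
  \<comment> \<open>The parameter of the orthogonal projection of \<open>z\<close> onto the
    line.\<close>
  define t where "t = ((z - a) \<bullet> d) / (norm d)\<^sup>2"
  have shift: "wedge d (z - (a + s *\<^sub>R d)) = wedge d (z - a)" for s
    by (simp add: wedge_def algebra_simps)
  have "infdist z (affine hull {a, b}) = (INF p \<in> affine hull {a, b}. dist z p)"
    by (simp add: infdist_def line)
  also have "\<dots> = \<bar>wedge d (z - a)\<bar> / norm d"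
  proof (rule cInf_eq_minimum)
    have "d \<bullet> (z - (a + t *\<^sub>R d)) = 0"
      using d by (simp add: t_def inner_diff_right inner_add_right inner_commute
          power2_norm_eq_inner field_simps)
    then have "(norm d * norm (z - (a + t *\<^sub>R d)))\<^sup>2 = \<bar>wedge d (z - a)\<bar>\<^sup>2"
      using wedge_Lagrange[of d "z - (a + t *\<^sub>R d)"] shift[of t] by (simp add: power_mult_distrib)
    then have "norm d * norm (z - (a + t *\<^sub>R d)) = \<bar>wedge d (z - a)\<bar>"
      by (simp only: power2_eq_iff_nonneg abs_ge_zero mult_nonneg_nonneg norm_ge_zero)
    then show "\<bar>wedge d (z - a)\<bar> / norm d \<in> dist z ` (affine hull {a, b})"
      using d unfolding line by (auto simp: dist_norm field_simps intro!: image_eqI[of _ _ "a + t *\<^sub>R d"])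
  next
    fix x assume "x \<in> dist z ` (affine hull {a, b})"
    then obtain s where x: "x = norm (z - (a + s *\<^sub>R d))" by (auto simp: line dist_norm)
    have "\<bar>wedge d (z - a)\<bar> \<le> norm d * x"
    proof (rule power2_le_imp_le)
      show "\<bar>wedge d (z - a)\<bar>\<^sup>2 \<le> (norm d * x)\<^sup>2"
        using wedge_Lagrange[of d "z - (a + s *\<^sub>R d)"]
        by (simp add: shift x power_mult_distrib) (metis le_add_same_cancel1 zero_le_power2)
    qed (simp add: x)
    then show "\<bar>wedge d (z - a)\<bar> / norm d \<le> x" using d by (simp add: field_simps)
  qed
  finally show ?thesis by (simp add: d_def)
qed

section \<open>Circumradius, inradius and radius ratio in closed form\<close>

definition orientation :: "(nat \<Rightarrow> real^2) \<Rightarrow> real" where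
  "orientation x = wedge (x 1 - x 0) (x 2 - x 0)"

lemma positively_oriented_iff: "positively_oriented x \<longleftrightarrow> orientation x > 0"
  by (simp add: positively_oriented_def orientation_def wedge_def det_2 transpose_def algebra_simps)

lemma lessThan_3: "{..<3} = {0, 1, 2::nat}"
  by auto

lemma triangle_hull_eq: "triangle_hull x = convex hull {x 0, x 1, x 2}"
  by (simp add: triangle_hull_def lessThan_3)

lemma edge_length_simps:
  "edge_length x 0 = norm (x 1 - x 2)"
  "edge_length x (Suc 0) = norm (x 2 - x 0)"
  "edge_length x 2 = norm (x 0 - x 1)"
  by (simp_all add: edge_length_def numeral_2_eq_2)

lemma triangle_area_eq: "triangle_area x = \<bar>orientation x\<bar> / 2"
  by (simp add: triangle_area_def triangle_hull_eq content_triangle orientation_def wedge_def) (simp add: algebra_simps)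

lemma edge_length_pos:
  assumes "orientation x \<noteq> 0"
  shows "edge_length x 0 > 0" "edge_length x 1 > 0" "edge_length x 2 > 0"
  using assms by (auto simp: edge_length_simps orientation_def wedge_def)

text \<open>With \<open>x 0\<close> as origin, equidistance from the vertices is a linear system for
  the centre with determinant proportional to \<open>D\<close>. Its unique solution shows that the
  definite description is well defined.\<close>

lemma circumradius_eq:
  assumes "orientation x \<noteq> 0"
  shows "circumradius x =
    edge_length x 0 * edge_length x 1 * edge_length x 2 / (2 * \<bar>orientation x\<bar>)"
proof -
  define b c where "b = x 1 - x 0" and "c = x 2 - x 0"
  define D where "D = orientation x"
  have D: "D = b $ 1 * c $ 2 - b $ 2 * c $ 1" "D \<noteq> 0"
    using assms by (simp_all add: D_def b_def c_def orientation_def wedge_def)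
  let ?R = "edge_length x 0 * edge_length x 1 * edge_length x 2 / (2 * \<bar>D\<bar>)"
  \<comment> \<open>The circumcentre relative to \<open>x 0\<close>, by Cramer's rule for
    \<open>2 * (y \<bullet> b) = (norm b)\<^sup>2\<close> and
    \<open>2 * (y \<bullet> c) = (norm c)\<^sup>2\<close>.\<close>
  define w :: "real^2" where "w = vector
      [((norm b)\<^sup>2 * c $ 2 - (norm c)\<^sup>2 * b $ 2) / (2 * D),
       ((norm c)\<^sup>2 * b $ 1 - (norm b)\<^sup>2 * c $ 1) / (2 * D)]"
  have equidist: "(\<forall>i<3. dist z (x i) = R) \<longleftrightarrow> z = x 0 + w \<and> R = norm w" for z R
  proof -
    have bc: "x 1 = x 0 + b" "x 2 = x 0 + c" by (simp_all add: b_def c_def)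
    define y where "y = z - x 0"
    \<comment> \<open>Being as far from \<open>u\<close> as from the origin means lying on their
      perpendicular bisector, which is a linear condition on \<open>y\<close>.\<close>
    have nb: "(norm (y - u) = norm y) = (2 * (y \<bullet> u) = (norm u)\<^sup>2)" for u
      by (simp add: norm_eq_square[symmetric] norm_eq inner_diff_left inner_diff_right inner_commute
          power2_norm_eq_inner) auto
    have "(\<forall>i<3. dist z (x i) = R) \<longleftrightarrow> norm y = R \<and> norm (y - b) = R \<and> norm (y - c) = R"
      unfolding Ball_def[symmetric] lessThan_iff[symmetric] lessThan_3
      using bc by (simp add: dist_norm y_def algebra_simps)
    also have "\<dots> \<longleftrightarrow> R = norm y \<and> 2 * (y \<bullet> b) = (norm b)\<^sup>2 \<and> 2 * (y \<bullet> c) = (norm c)\<^sup>2"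
      using nb by auto
    also have "2 * (y \<bullet> b) = (norm b)\<^sup>2 \<and> 2 * (y \<bullet> c) = (norm c)\<^sup>2 \<longleftrightarrow> y = w"
    proof
      assume *: "2 * (y \<bullet> b) = (norm b)\<^sup>2 \<and> 2 * (y \<bullet> c) = (norm c)\<^sup>2"
      show "y = w"
        unfolding vec_eq_iff forall_2 w_def vector_2 *[THEN conjunct1, symmetric] *[THEN conjunct2, symmetric]
        using D(2) by (simp add: field_simps) (simp add: D(1) inner_real2 algebra_simps)
    next
      assume y: "y = w"
      show "2 * (y \<bullet> b) = (norm b)\<^sup>2 \<and> 2 * (y \<bullet> c) = (norm c)\<^sup>2"
        unfolding y w_def inner_real2 vector_2
        using D(2) by (simp add: field_simps) (simp add: D(1) algebra_simps)
    qed
    finally show ?thesis by (auto simp: y_def algebra_simps)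
  qed
  have "norm w = ?R"
  proof (rule power2_eq_imp_eq)
    \<comment> \<open>Up to a quarter turn, \<open>2 * D\<close> times \<open>w\<close> is |b|^2 c -
      |c|^2 b, whose squared length factors into the three squared edge lengths.\<close>
    have "(2 * D)\<^sup>2 * (norm w)\<^sup>2 = (norm (b - c))\<^sup>2 * (norm c)\<^sup>2 * (norm b)\<^sup>2"
    proof -
      have 1: "(2 * D) * w $ 1 = (norm b)\<^sup>2 * c $ 2 - (norm c)\<^sup>2 * b $ 2"
        and 2: "(2 * D) * w $ 2 = (norm c)\<^sup>2 * b $ 1 - (norm b)\<^sup>2 * c $ 1"
        using D(2) by (simp_all add: w_def)
      have "(2 * D)\<^sup>2 * (norm w)\<^sup>2 = ((2 * D) * w $ 1)\<^sup>2 + ((2 * D) * w $ 2)\<^sup>2"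
        by (simp add: power2_norm_real2 power_mult_distrib algebra_simps)
      also have "\<dots> = (norm (b - c))\<^sup>2 * (norm c)\<^sup>2 * (norm b)\<^sup>2"
        unfolding 1 2 power2_norm_real2 vector_minus_component by algebra
      finally show ?thesis .
    qed
    moreover have "b - c = x 1 - x 2" "norm b = norm (x 0 - x 1)"
      by (simp_all add: b_def c_def norm_minus_commute)
    ultimately show "(norm w)\<^sup>2 = ?R\<^sup>2"
      using D(2) by (simp add: edge_length_simps c_def power_divide power_mult_distrib field_simps)
  qed (simp_all add: edge_length_simps)
  then show ?thesis
    unfolding circumradius_def equidist by (simp add: D_def)
qed

text \<open>The distances from a point of the triangle to the sides are its barycentric coordinates
  times the heights. Tangency to all sides therefore makes the coordinates proportional to the edge
  lengths, and their sum 1 determines the radius.\<close>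

lemma inradius_eq:
  assumes "orientation x \<noteq> 0"
  shows "inradius x = \<bar>orientation x\<bar> / perimeter x"
proof -
  define D where "D = orientation x"
  have D: "D \<noteq> 0" using assms by (simp add: D_def)
  let ?l = "edge_length x"
  have l: "?l 0 > 0" "?l 1 > 0" "?l 2 > 0" using edge_length_pos assms by auto
  have p: "perimeter x = ?l 0 + ?l 1 + ?l 2" "perimeter x > 0"
    using l by (auto simp: perimeter_def)
  have ne: "x 1 \<noteq> x 2" "x 2 \<noteq> x 0" "x 0 \<noteq> x 1"
    using l by (auto simp: edge_length_simps)
  \<comment> \<open>The weights are nonnegative, so the absolute values affect only \<open>D\<close>
    and the three equations are linear in the weights and \<open>r\<close>.\<close>
  have dist: "(\<forall>i<3. infdist z (affine hull (x ` ({..<3} - {i}))) = r) \<longleftrightarrow>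
      u * \<bar>D\<bar> = r * ?l 0 \<and> v * \<bar>D\<bar> = r * ?l 1 \<and> w * \<bar>D\<bar> = r * ?l 2"
    if z: "z = u *\<^sub>R x 0 + v *\<^sub>R x 1 + w *\<^sub>R x 2" "u \<ge> 0" "v \<ge> 0" "w \<ge> 0" "u + v + w = 1"
    for z r u v w
  proof -
    have u: "u = 1 - v - w" using z by simp
    have D_eq: "D = wedge (x 1 - x 0) (x 2 - x 0)" by (simp add: D_def orientation_def)
    \<comment> \<open>Twice the signed areas of the triangles that \<open>z\<close> spans with the
      edges.\<close>
    have "wedge (x 2 - x 1) (z - x 1) = u * D" "wedge (x 0 - x 2) (z - x 2) = v * D"
         "wedge (x 1 - x 0) (z - x 0) = w * D"
      unfolding z(1) u D_eq wedge_def by (simp_all add: algebra_simps)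
    then have "infdist z (affine hull {x 1, x 2}) = u * \<bar>D\<bar> / ?l 0"
      "infdist z (affine hull {x 2, x 0}) = v * \<bar>D\<bar> / ?l 1"
      "infdist z (affine hull {x 0, x 1}) = w * \<bar>D\<bar> / ?l 2"
      using ne z by (simp_all add: infdist_line edge_length_simps norm_minus_commute abs_mult)
    moreover have "{..<3} - {0} = {1, 2::nat}" "{..<3} - {1} = {2, 0::nat}" "{..<3} - {2} = {0, 1::nat}"
      by auto
    moreover have "(\<forall>i<3. P i) \<longleftrightarrow> P 0 \<and> P 1 \<and> P 2" for P :: "nat \<Rightarrow> bool"
      by (auto simp: numeral_3_eq_3 numeral_2_eq_2 less_Suc_eq)
    ultimately show ?thesis using l by (simp del: One_nat_def add: divide_eq_eq)
  qed
  show ?thesis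
    unfolding inradius_def D_def[symmetric]
  proof (rule the_equality)
    let ?z = "(?l 0 / perimeter x) *\<^sub>R x 0 + (?l 1 / perimeter x) *\<^sub>R x 1 + (?l 2 / perimeter x) *\<^sub>R x 2"
    have sum1: "?l 0 / perimeter x + ?l 1 / perimeter x + ?l 2 / perimeter x = 1"
      using p by (simp add: add_divide_distrib[symmetric])
    then have "?z \<in> triangle_hull x"
      unfolding triangle_hull_eq convex_hull_3
      using l p by (intro CollectI exI conjI) (auto intro!: divide_nonneg_pos)
    moreover have "\<forall>i<3. infdist ?z (affine hull (x ` ({..<3} - {i}))) = \<bar>D\<bar> / perimeter x"
      using l p(2) sum1 by (subst dist[OF refl]) auto
    ultimately show "\<exists>z\<in>triangle_hull x. \<forall>i<3. infdist z (affine hull (x ` ({..<3} - {i}))) = \<bar>D\<bar> / perimeter x"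
      by blast
  next
    fix r assume "\<exists>z\<in>triangle_hull x. \<forall>i<3. infdist z (affine hull (x ` ({..<3} - {i}))) = r"
    then obtain u v w where uvw: "u \<ge> 0" "v \<ge> 0" "w \<ge> 0" "u + v + w = 1"
      and "\<forall>i<3. infdist (u *\<^sub>R x 0 + v *\<^sub>R x 1 + w *\<^sub>R x 2) (affine hull (x ` ({..<3} - {i}))) = r"
      unfolding triangle_hull_eq convex_hull_3 by blast
    then have "u * \<bar>D\<bar> = r * ?l 0 \<and> v * \<bar>D\<bar> = r * ?l 1 \<and> w * \<bar>D\<bar> = r * ?l 2"
      using dist[OF refl] by blast
    then have "(u + v + w) * \<bar>D\<bar> = r * perimeter x"
      by (simp add: p algebra_simps)
    then show "r = \<bar>D\<bar> / perimeter x" using uvw(4) p(2) by (simp add: eq_divide_eq)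
  qed
qed

text \<open>The two factors \<open>\<bar>orientation x\<bar>\<close> combine into a square, so no
  absolute value is left to differentiate.\<close>

lemma radius_ratio_eq:
  assumes "orientation x \<noteq> 0"
  shows "radius_ratio x = perimeter x * (edge_length x 0 * edge_length x 1 * edge_length x 2) /
           (2 * orientation x)\<^sup>2"
  using assms by (simp add: radius_ratio_def circumradius_eq inradius_eq power2_eq_square)

section \<open>Algebraic properties of the element matrices\<close>

lemma sum_lessThan_3: "sum f {..<3} = f 0 + f 1 + f (2::nat)"
  by (simp add: lessThan_3 add.assoc)

lemma coeff_c_nonneg: "coeff_c x i \<ge> 0"
  by (simp add: coeff_c_def perimeter_def edge_length_def)

lemma radius_ratio_nonneg: "orientation x \<noteq> 0 \<Longrightarrow> radius_ratio x \<ge> 0"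
  by (simp add: radius_ratio_eq perimeter_def edge_length_def)

lemma element_A_commute: "a < 3 \<Longrightarrow> b < 3 \<Longrightarrow> element_A x a b = element_A x b a"
  by (auto simp: numeral_3_eq_3 less_Suc_eq element_A_def Let_def)

lemma element_B_anticommute: "a < 3 \<Longrightarrow> b < 3 \<Longrightarrow> element_B x a b = - element_B x b a"
  by (auto simp: numeral_3_eq_3 less_Suc_eq element_B_def Let_def)

lemma element_A_row_sum: "a < 3 \<Longrightarrow> (\<Sum>b<3. element_A x a b) = 0"
  by (auto simp: numeral_3_eq_3 less_Suc_eq element_A_def Let_def algebra_simps)

lemma element_A_offdiag_nonpos:
  assumes "orientation x \<noteq> 0" "a < 3" "b < 3" "a \<noteq> b"
  shows "element_A x a b \<le> 0"
  using assms(2-4) radius_ratio_nonneg[OF assms(1)] coeff_c_nonneg[of x]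
  by (auto simp: numeral_3_eq_3 less_Suc_eq element_A_def Let_def)

section \<open>Derivative of the radius ratio of one triangle\<close>

definition rot_clockwise :: "real^2 \<Rightarrow> real^2" where
  "rot_clockwise u = vector [u $ 2, - u $ 1]"

text \<open>The vertices depend on an arbitrary parameter, so the lemma applies directly to a
  triangle moving with the coordinates of the whole mesh. The rotation enters through
  \<open>wedge u v = u \<bullet> rot_clockwise v\<close>.\<close>

lemma radius_ratio_has_derivative:
  fixes x :: "'b::real_normed_vector \<Rightarrow> nat \<Rightarrow> real^2"
  assumes x': "\<And>a. a < 3 \<Longrightarrow> ((\<lambda>v. x v a) has_derivative x' a) (at v)"
    and or: "orientation (x v) > 0"
  shows "((\<lambda>v. radius_ratio (x v)) has_derivative
           (\<lambda>h. \<Sum>a<3. x' a h \<bullet> (\<Sum>b<3. element_A (x v) a b *\<^sub>R x v b +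
                                          element_B (x v) a b *\<^sub>R rot_clockwise (x v b)))) (at v)"
proof -
  define D l where "D = orientation (x v)" and "l = edge_length (x v)"
  define p where "p = perimeter (x v)"
  have pos: "D > 0" "l 0 > 0" "l 1 > 0" "l 2 > 0" "p > 0"
    using or edge_length_pos[of "x v"] by (auto simp: D_def l_def p_def perimeter_def)
  have p: "p = l 0 + l 1 + l 2" by (simp add: p_def l_def perimeter_def)
  define D' where "D' h = wedge (x' 1 h - x' 0 h) (x v 2 - x v 0) + wedge (x v 1 - x v 0) (x' 2 h - x' 0 h)" for h
  \<comment> \<open>The derivative of half the squared edge length; dividing by the length gives the
    derivative of the length itself.\<close>
  define e where "e j k h = (x v j - x v k) \<bullet> (x' j h - x' k h)" for j k h
  have comp: "((\<lambda>v. x v a $ i) has_derivative (\<lambda>h. x' a h $ i)) (at v)" if "a < 3" for a i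
    by (rule bounded_linear.has_derivative[OF bounded_linear_vec_nth x'[OF that]])
  have D': "((\<lambda>v. orientation (x v)) has_derivative D') (at v)"
    unfolding orientation_def wedge_def D'_def
    by (rule derivative_eq_intros comp refl | simp)+ (simp add: algebra_simps)
  have dnorm: "((\<lambda>v. norm (x v j - x v k)) has_derivative (\<lambda>h. e j k h / norm (x v j - x v k))) (at v)"
    if "j < 3" "k < 3" "norm (x v j - x v k) > 0" for j k
    using has_derivative_compose[OF has_derivative_diff[OF x'[OF that(1)] x'[OF that(2)]] has_derivative_norm] that(3)
    by (simp add: sgn_div_norm e_def inner_commute divide_inverse mult.commute)
  have l': "((\<lambda>v. edge_length (x v) 0) has_derivative (\<lambda>h. e 1 2 h / edge_length (x v) 0)) (at v)"
    "((\<lambda>v. edge_length (x v) 1) has_derivative (\<lambda>h. e 2 0 h / edge_length (x v) 1)) (at v)"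
    "((\<lambda>v. edge_length (x v) 2) has_derivative (\<lambda>h. e 0 1 h / edge_length (x v) 2)) (at v)"
    using pos dnorm[of 1 2] dnorm[of 2 0] dnorm[of 0 1] by (simp_all add: edge_length_simps l_def)
  define f where "f v = perimeter (x v) * (edge_length (x v) 0 * edge_length (x v) 1 * edge_length (x v) 2) /
    (2 * orientation (x v))\<^sup>2" for v
  have rr: "radius_ratio (x v) = p * (l 0 * l 1 * l 2) / (2 * D)\<^sup>2"
    using or by (simp add: radius_ratio_eq p_def l_def D_def)
  define M where "M = radius_ratio (x v)"
  define c where "c = coeff_c (x v)"
  have c: "c i = 1 / (p * l i) + 1 / (l i)\<^sup>2" for i
    by (simp add: c_def coeff_c_def p_def l_def)
  \<comment> \<open>Logarithmic differentiation: the edge opposite vertex \<open>i\<close>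
    contributes its \<open>e\<close> term over \<open>p * l i\<close> through the perimeter and over
    \<open>(l i)\<^sup>2\<close> through its own factor, together \<open>c i\<close>. The factor
    \<open>D\<close> to the power -2 gives the last term.\<close>
  have "(f has_derivative (\<lambda>h. M * (c 0 * e 1 2 h + c 1 * e 2 0 h + c 2 * e 0 1 h - 2 * D' h / D))) (at v)"
    unfolding f_def perimeter_def
  proof (rule has_derivative_eq_rhs[OF _ ext])
    fix h
    \<comment> \<open>The left side is what the product, power and quotient rules yield for
      \<open>f\<close>.\<close>
    show "- ((l 0 + l 1 + l 2) * (l 0 * l 1 * l 2)) *
         (inverse ((2 * D)\<^sup>2) * (real 2 * (2 * D' h) * (2 * D) ^ (2 - 1)) * inverse ((2 * D)\<^sup>2)) +
         ((l 0 + l 1 + l 2) * (l 0 * l 1 * (e 0 1 h / l 2) +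
           (l 0 * (e 2 0 h / l 1) + e 1 2 h / l 0 * l 1) * l 2) +
          (e 1 2 h / l 0 + e 2 0 h / l 1 + e 0 1 h / l 2) * (l 0 * l 1 * l 2)) / (2 * D)\<^sup>2 =
      M * (c 0 * e 1 2 h + c 1 * e 2 0 h + c 2 * e 0 1 h - 2 * D' h / D)"
      unfolding M_def rr c p[symmetric] using pos by (simp add: field_simps power2_eq_square)
  qed (unfold l_def D_def, (rule derivative_intros l' D')+, use or in simp)
  also have "(\<lambda>h. M * (c 0 * e 1 2 h + c 1 * e 2 0 h + c 2 * e 0 1 h - 2 * D' h / D)) =
    (\<lambda>h. \<Sum>a<3. x' a h \<bullet> (\<Sum>b<3. element_A (x v) a b *\<^sub>R x v b +
                                   element_B (x v) a b *\<^sub>R rot_clockwise (x v b)))"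
  proof
    fix h
    define k where "k = 1 / triangle_area (x v)"
    have k: "2 * D' h / D = k * D' h"
      using pos by (simp add: k_def triangle_area_eq D_def)
    \<comment> \<open>Collected by vertices, the edge terms form the Laplacian of the triangle with
      weight \<open>c i\<close> on the edge opposite \<open>i\<close>. In \<open>D'\<close> the
      vector paired with \<open>x' 0 h\<close> is \<open>rot_clockwise (x v 1 - x v 2)\<close>, and
      cyclically; this gives the rows of the element matrix B.\<close>
    show "M * (c 0 * e 1 2 h + c 1 * e 2 0 h + c 2 * e 0 1 h - 2 * D' h / D) =
     (\<Sum>a<3. x' a h \<bullet> (\<Sum>b<3. element_A (x v) a b *\<^sub>R x v b +
                                   element_B (x v) a b *\<^sub>R rot_clockwise (x v b)))"
      unfolding k unfolding sum_lessThan_3 D'_def e_def wedge_def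
      by (simp add: element_A_def element_B_def Let_def M_def[symmetric] c_def[symmetric]
          k_def[symmetric] inner_real2 rot_clockwise_def algebra_simps)
  qed
  finally have "(f has_derivative \<dots>) (at v)" .
  \<comment> \<open>The closed form is available only for nonzero orientation; by continuity the
    orientation stays positive near \<open>v\<close>.\<close>
  moreover have "\<forall>\<^sub>F v' in at v. f v' = radius_ratio (x v')"
  proof -
    have "((\<lambda>v. orientation (x v)) \<longlongrightarrow> orientation (x v)) (at v)"
      using has_derivative_continuous[OF D'] by (simp add: continuous_within)
    from order_tendstoD(1)[OF this or] show ?thesis
      by eventually_elim (simp add: f_def radius_ratio_eq)
  qed
  ultimately show ?thesis
    by (rule has_derivative_transform_eventually) (use or in \<open>simp_all add: f_def radius_ratio_eq\<close>)
qed

section \<open>Assembly and the properties of the global matrices\<close>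

lemma assemble_nth:
  "assemble Nc g M $ i $ j = 1 / real Nc *
     (\<Sum>n<Nc. \<Sum>a<3. \<Sum>b<3. if g n a = i \<and> g n b = j then M n a b else 0)"
proof -
  have "(\<Sum>(a, b) \<in> {(a, b). a < 3 \<and> b < 3 \<and> g n a = i \<and> g n b = j}. M n a b) =
     (\<Sum>a<3. \<Sum>b<3. if g n a = i \<and> g n b = j then M n a b else 0)" for n
    unfolding sum.cartesian_product
    by (rule sum.mono_neutral_cong_left) (auto split: if_splits)
  then show ?thesis by (simp add: assemble_def)
qed

text \<open>The sum over the global column index collapses to \<open>j = g n b\<close>: local values
  are gathered from \<open>Z\<close>, multiplied by the element matrix and added into row
  \<open>i\<close>.\<close>

lemma assemble_mult_nth:
  "(assemble Nc g M *v Z) $ i = 1 / real Nc *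
     (\<Sum>n<Nc. \<Sum>a<3. if g n a = i then \<Sum>b<3. M n a b * Z $ g n b else 0)"
proof -
  have "(\<Sum>j\<in>UNIV. (if g n a = i \<and> g n b = j then M n a b else 0) * Z $ j) =
      (if g n a = i then M n a b * Z $ g n b else 0)" for n a b
    by (simp add: if_distrib[of "\<lambda>u. u * _"] sum.delta cong: if_cong)
  then have "(\<Sum>j\<in>UNIV. \<Sum>n<Nc. \<Sum>a<3. \<Sum>b<3. (if g n a = i \<and> g n b = j then M n a b else 0) * Z $ j)
     = (\<Sum>n<Nc. \<Sum>a<3. \<Sum>b<3. if g n a = i then M n a b * Z $ g n b else 0)"
    by (simp only: sum.swap[where A = UNIV])
  moreover have "(\<Sum>b<3. if g n a = i then M n a b * Z $ g n b else 0) =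
     (if g n a = i then \<Sum>b<3. M n a b * Z $ g n b else 0)" for n a
    by simp
  ultimately show ?thesis
    by (simp add: matrix_vector_mult_def assemble_nth sum_distrib_right[symmetric] sum_divide_distrib[symmetric])
qed

lemma transpose_assemble: "transpose (assemble Nc g M) = assemble Nc g (\<lambda>n a b. M n b a)"
  unfolding vec_eq_iff transpose_def assemble_nth vec_lambda_beta
  by (subst (2) sum.swap) (simp add: conj_commute)

lemma assemble_cong:
  assumes "\<And>n a b. n < Nc \<Longrightarrow> a < 3 \<Longrightarrow> b < 3 \<Longrightarrow> M n a b = M' n a b"
  shows "assemble Nc g M = assemble Nc g M'"
  unfolding vec_eq_iff assemble_nth using assms by (auto intro!: sum.cong)

lemma assemble_uminus: "assemble Nc g (\<lambda>n a b. - M n a b) = - assemble Nc g M"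
proof -
  have "(if P then - u else 0) = - (if P then u else 0)" for P and u :: real
    by simp
  then show ?thesis
    unfolding vec_eq_iff assemble_nth vector_uminus_component by (simp add: sum_negf)
qed

lemma laplacian_matrix_A:
  assumes "\<And>n. n < Nc \<Longrightarrow> orientation (mesh_triangle g V n) \<noteq> 0"
  shows "laplacian_matrix (matrix_A Nc g V)"
  unfolding laplacian_matrix_def
proof (intro conjI allI impI)
  show "transpose (matrix_A Nc g V) = matrix_A Nc g V"
    unfolding matrix_A_def transpose_assemble by (intro assemble_cong element_A_commute)
  \<comment> \<open>Local indices with distinct global images are distinct, so only off-diagonal
    element entries contribute.\<close>
  show "matrix_A Nc g V $ i $ j \<le> 0" if "i \<noteq> j" for i j
    unfolding matrix_A_def assemble_nth using that assms
    by (intro mult_nonneg_nonpos sum_nonpos) (auto intro!: element_A_offdiag_nonpos)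
  \<comment> \<open>Row sums are the action on the constant vector 1, which reduces them to the row
    sums of the element matrices.\<close>
  have "(\<Sum>j\<in>UNIV. matrix_A Nc g V $ i $ j) = (matrix_A Nc g V *v (\<chi> j. 1)) $ i" for i
    by (simp add: matrix_vector_mult_def)
  then show "(\<Sum>j\<in>UNIV. matrix_A Nc g V $ i $ j) = 0" for i
    by (simp add: matrix_A_def assemble_mult_nth element_A_row_sum cong: if_cong)
qed

lemma antisymmetric_matrix_B: "antisymmetric_matrix (matrix_B Nc g V)"
  unfolding antisymmetric_matrix_def matrix_B_def transpose_assemble assemble_uminus[symmetric]
  by (intro assemble_cong element_B_anticommute)

section \<open>Stacked vectors and pairings with assembled matrices\<close>

lemma sum_UNIV_Plus:
  fixes f :: "'a::finite + 'b::finite \<Rightarrow> 'c::comm_monoid_add"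
  shows "sum f UNIV = (\<Sum>i\<in>UNIV. f (Inl i)) + (\<Sum>i\<in>UNIV. f (Inr i))"
  by (subst UNIV_Plus_UNIV[symmetric], subst sum.Plus) (simp_all add: comp_def)

lemma block_matrix_mult_stack:
  "block_matrix P Q R S *v stack X Y = stack (P *v X + Q *v Y) (R *v X + S *v Y)"
  unfolding vec_eq_iff
  by (auto simp: matrix_vector_mult_def block_matrix_def stack_def sum_UNIV_Plus split: sum.split)

lemma inner_stack: "h \<bullet> stack U W = (\<Sum>i\<in>UNIV. h $ Inl i * U $ i + h $ Inr i * W $ i)"
  by (simp add: inner_vec_def stack_def sum_UNIV_Plus sum.distrib)

text \<open>Turns a pairing over global vertices into a sum over triangles and their local vertices,
  the form in which the derivative of the mean radius ratio appears.\<close>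

lemma inner_assemble_mult:
  "(\<Sum>i\<in>UNIV. u i * (assemble Nc g M *v Z) $ i) =
     1 / real Nc * (\<Sum>n<Nc. \<Sum>a<3. u (g n a) * (\<Sum>b<3. M n a b * Z $ g n b))"
proof -
  have "(\<Sum>i\<in>UNIV. u i * (assemble Nc g M *v Z) $ i) = 1 / real Nc *
     (\<Sum>i\<in>UNIV. \<Sum>n<Nc. \<Sum>a<3. if g n a = i then u i * (\<Sum>b<3. M n a b * Z $ g n b) else 0)"
    unfolding assemble_mult_nth
    by (simp add: sum_distrib_left mult.left_commute if_distrib[of "\<lambda>t. _ * t"] cong: if_cong)
  also have "(\<Sum>i\<in>UNIV. \<Sum>n<Nc. \<Sum>a<3. if g n a = i then u i * (\<Sum>b<3. M n a b * Z $ g n b) else 0) =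
    (\<Sum>n<Nc. \<Sum>a<3. u (g n a) * (\<Sum>b<3. M n a b * Z $ g n b))"
    by (subst sum.swap, rule sum.cong[OF refl], subst sum.swap) (simp add: sum.delta')
  finally show ?thesis .
qed

lemma mesh_vertex_has_derivative:
  "((\<lambda>V. mesh_vertex V i) has_derivative (\<lambda>h. mesh_vertex h i)) (at V)"
proof -
  have "linear (\<lambda>V. mesh_vertex V i)"
    by (rule linearI) (simp_all add: mesh_vertex_def vec_eq_iff forall_2)
  then show ?thesis by (simp add: linear_imp_has_derivative)
qed

lemma mesh_vertex_stack: "mesh_vertex (stack X Y) i = vector [X $ i, Y $ i]"
  by (simp add: mesh_vertex_def stack_def)

theorem theorem2p1:
  fixes X Y :: "real^'v::finite"
    and Nc :: nat
    and g :: "nat \<Rightarrow> nat \<Rightarrow> 'v"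
  assumes "planar_triangulation Nc g (stack X Y)"
  shows "(GDERIV (mean_radius_ratio Nc g) (stack X Y) :>
            block_matrix (matrix_A Nc g (stack X Y)) (matrix_B Nc g (stack X Y))
                         (- matrix_B Nc g (stack X Y)) (matrix_A Nc g (stack X Y))
            *v stack X Y)
         \<and> laplacian_matrix (matrix_A Nc g (stack X Y))
         \<and> antisymmetric_matrix (matrix_B Nc g (stack X Y))"
proof (intro conjI)
  let ?V = "stack X Y"
  let ?T = "mesh_triangle g ?V"
  have or: "orientation (?T n) > 0" if "n < Nc" for n
    using assms that by (simp add: planar_triangulation_def positively_oriented_iff)
  show "laplacian_matrix (matrix_A Nc g ?V)"
    using or by (intro laplacian_matrix_A) force
  show "antisymmetric_matrix (matrix_B Nc g ?V)"
    by (rule antisymmetric_matrix_B)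
  \<comment> \<open>The gradient of the radius ratio of triangle \<open>n\<close> with respect to
    its local vertex \<open>a\<close>.\<close>
  let ?G = "\<lambda>n a. \<Sum>b<3. element_A (?T n) a b *\<^sub>R ?T n b + element_B (?T n) a b *\<^sub>R rot_clockwise (?T n b)"
  have "((\<lambda>V. radius_ratio (mesh_triangle g V n)) has_derivative
      (\<lambda>h. \<Sum>a<3. mesh_vertex h (g n a) \<bullet> ?G n a)) (at ?V)" if "n < Nc" for n
    by (rule radius_ratio_has_derivative[where x = "\<lambda>V. mesh_triangle g V n"
          and x' = "\<lambda>a h. mesh_vertex h (g n a)", OF _ or[OF that]])
       (simp add: mesh_triangle_def mesh_vertex_has_derivative)
  then have "(mean_radius_ratio Nc g has_derivative
      (\<lambda>h. 1 / real Nc * (\<Sum>n<Nc. \<Sum>a<3. mesh_vertex h (g n a) \<bullet> ?G n a))) (at ?V)"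
    unfolding mean_radius_ratio_def
    by (intro has_derivative_mult_right has_derivative_sum) auto
  also have "(\<lambda>h. 1 / real Nc * (\<Sum>n<Nc. \<Sum>a<3. mesh_vertex h (g n a) \<bullet> ?G n a)) =
    (\<lambda>h. h \<bullet> stack (matrix_A Nc g ?V *v X + matrix_B Nc g ?V *v Y)
                   (- matrix_B Nc g ?V *v X + matrix_A Nc g ?V *v Y))"
  proof
    fix h
    \<comment> \<open>Since \<open>rot_clockwise\<close> sends (x, y) to (y, -x), the two
      coordinates of \<open>?G n a\<close> produce the block rows A, B and -B, A.\<close>
    have G: "mesh_vertex h (g n a) \<bullet> ?G n a =
        h $ Inl (g n a) * (\<Sum>b<3. element_A (?T n) a b * X $ g n b) +
        h $ Inl (g n a) * (\<Sum>b<3. element_B (?T n) a b * Y $ g n b) +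
        h $ Inr (g n a) * (\<Sum>b<3. - element_B (?T n) a b * X $ g n b) +
        h $ Inr (g n a) * (\<Sum>b<3. element_A (?T n) a b * Y $ g n b)" for n a
      by (simp add: mesh_vertex_def[of h] inner_real2 mesh_triangle_def mesh_vertex_stack rot_clockwise_def
          sum.distrib sum_negf algebra_simps)
    show "1 / real Nc * (\<Sum>n<Nc. \<Sum>a<3. mesh_vertex h (g n a) \<bullet> ?G n a) =
      h \<bullet> stack (matrix_A Nc g ?V *v X + matrix_B Nc g ?V *v Y)
                 (- matrix_B Nc g ?V *v X + matrix_A Nc g ?V *v Y)"
      unfolding G unfolding inner_stack matrix_A_def matrix_B_def assemble_uminus[symmetric]
        vector_add_component distrib_left sum.distrib inner_assemble_mult
      by (simp add: add.assoc)
  qed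
  finally show "GDERIV (mean_radius_ratio Nc g) ?V :>
      block_matrix (matrix_A Nc g ?V) (matrix_B Nc g ?V) (- matrix_B Nc g ?V) (matrix_A Nc g ?V) *v ?V"
    unfolding gderiv_def block_matrix_mult_stack .
qed

end
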